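(* Let $n\ge 1$ and let $G$ be the one-loop Feynman graph with $n$ internal edges and $n$ external edges (an $n$-cycle with one external edge attached at each vertex). For every quadratic form $f\in\mathbb{R}[x_1,\dots,x_n]_2$ there exist kinematic parameters $z=(k_{ij},m_e)$, that is, real numbers $m_1,\dots,m_n$ and a real symmetric $n\times n$ matrix $(k_{ij})$ all of whose row sums are zero, such that $f(x)$ equals the second Symanzik polynomial $\mathcal{F}_z(x)$ of $G$.
   Context: $\mathbb{R}[x_1,\dots,x_n]_2$ is the space of homogeneous polynomials of degree $2$ in $n$ variables with real coefficients. The one-loop graph $G$ is a cycle with vertices $v_1,\dots,v_n$ in cyclic order, where internal edge $i$ (with mass parameter $m_i$) joins $v_{i-1}$ and $v_i$ (indices cyclic, $v_0=v_n$), and exactly one external edge, labelled $a$, is attached at each vertex $v_a$. The kinematic parameters are arbitrary real numbers $m_1,\dots,m_n$ and an arbitrary real symmetric $n\times n$ matrix $K=(k_{ab})$ with zero row sums (momentum conservation); no rank or sign constraints are imposed. For $i<j$ put $I_i^j=\{i,\dots,j-1\}$, and $[n]=\{1,\dots,n\}$. The second Symanzik polynomial of $G$ is $$\mathcal{F}_z(x)=\sum_{i=1}^n m_i x_i^2+\sum_{i=1}^n\sum_{j=i+1}^n\Big(m_i+m_j+\sum_{a\in I_i^j}\ \sum_{b\in[n]\setminus I_i^j}k_{ab}\Big)x_ix_j .$$ *)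

theory Defs
  imports Complex_Main "HOL-Library.Poly_Mapping"
begin

text \<open>
  Real polynomials in variables \<open>x\<^sub>1, x\<^sub>2, \<dots>\<close>: a monomial is a finitely supported exponent vector,
  a polynomial a finitely supported coefficient function on monomials, multiplied by convolution.
\<close>
type_synonym rpoly = "(nat \<Rightarrow>\<^sub>0 nat) \<Rightarrow>\<^sub>0 real"

definition Var :: "nat \<Rightarrow> rpoly" where
  "Var i = Poly_Mapping.single (Poly_Mapping.single i 1) 1"

definition Const :: "real \<Rightarrow> rpoly" where
  "Const c = Poly_Mapping.single 0 c"

definition monom_degree :: "(nat \<Rightarrow>\<^sub>0 nat) \<Rightarrow> nat" where
  "monom_degree \<alpha> = (\<Sum>i\<in>Poly_Mapping.keys \<alpha>. Poly_Mapping.lookup \<alpha> i)"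

text \<open>The space \<open>\<real>[x\<^sub>1,\<dots>,x\<^sub>n]\<^sub>d\<close>; it contains the zero polynomial.\<close>
definition homogeneous_polys :: "nat \<Rightarrow> nat \<Rightarrow> rpoly set" where
  "homogeneous_polys n d =
     {f. \<forall>\<alpha>\<in>Poly_Mapping.keys f. Poly_Mapping.keys \<alpha> \<subseteq> {1..n} \<and> monom_degree \<alpha> = d}"

text \<open>
  Kinematic parameters of the one-loop graph: the masses are unconstrained reals, so only the
  matrix \<open>k\<close>, of which just the entries with indices in \<open>{1..n}\<close> matter, is subject to conditions
  (symmetry and momentum conservation).
\<close>
definition momentum_matrix :: "nat \<Rightarrow> (nat \<Rightarrow> nat \<Rightarrow> real) \<Rightarrow> bool" where
  "momentum_matrix n k \<longleftrightarrow>
     (\<forall>a\<in>{1..n}. \<forall>b\<in>{1..n}. k a b = k b a) \<and>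
     (\<forall>a\<in>{1..n}. (\<Sum>b\<in>{1..n}. k a b) = 0)"

text \<open>
  The one-loop graph with \<open>n\<close> internal edges is the cycle on \<open>v\<^sub>1,\<dots>,v\<^sub>n\<close> whose internal edge \<open>i\<close> joins
  \<open>v\<^sub>i\<^sub>-\<^sub>1\<close> and \<open>v\<^sub>i\<close> (with \<open>v\<^sub>0 = v\<^sub>n\<close>), with external edge \<open>a\<close> attached at \<open>v\<^sub>a\<close>. For \<open>i < j\<close>, cutting the
  internal edges \<open>i\<close> and \<open>j\<close> separates the external edges in \<open>arc i j\<close> from the remaining ones.
\<close>
definition arc :: "nat \<Rightarrow> nat \<Rightarrow> nat set" where
  "arc i j = {i..<j}"

definition symanzik_one_loop :: "nat \<Rightarrow> (nat \<Rightarrow> real) \<Rightarrow> (nat \<Rightarrow> nat \<Rightarrow> real) \<Rightarrow> rpoly" where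
  "symanzik_one_loop n m k =
     (\<Sum>i\<in>{1..n}. Const (m i) * Var i ^ 2) +
     (\<Sum>i\<in>{1..n}. \<Sum>j\<in>{i+1..n}.
        Const (m i + m j + (\<Sum>a\<in>arc i j. \<Sum>b\<in>{1..n} - arc i j. k a b)) * Var i * Var j)"

end

theory Submission
  imports Defs
begin

text \<open>
  The masses are forced: \<open>m\<^sub>i\<close> must be the coefficient of \<open>x\<^sub>i\<^sup>2\<close> in \<open>f\<close>. What remains is to realise
  arbitrary prescribed numbers \<open>s\<^sub>i\<^sub>j\<close> (\<open>i < j\<close>) as the flow \<open>\<Sum>k\<^sub>a\<^sub>b\<close> out of the arc \<open>{i..<j}\<close>. Momentum
  conservation on a cycle is solved by dual positions: if the momentum entering at \<open>v\<^sub>a\<close> is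
  \<open>p\<^sub>a = y\<^sub>a\<^sub>+\<^sub>1 - y\<^sub>a\<close> with \<open>y\<^sub>n\<^sub>+\<^sub>1 = y\<^sub>1\<close>, the momenta sum to zero and the momentum entering along
  \<open>{i..<j}\<close> telescopes to \<open>y\<^sub>j - y\<^sub>i\<close>. Since \<open>k\<^sub>a\<^sub>b = p\<^sub>a \<cdot> p\<^sub>b\<close> is subject to no rank or sign constraint, the
  Gram matrix \<open>g\<^sub>i\<^sub>j = y\<^sub>i \<cdot> y\<^sub>j\<close> may be any symmetric matrix at all. The flow out of the arc is
  \<open>-\<bar>y\<^sub>j - y\<^sub>i\<bar>\<^sup>2 = 2 g\<^sub>i\<^sub>j - g\<^sub>i\<^sub>i - g\<^sub>j\<^sub>j\<close>, so a zero diagonal and \<open>g\<^sub>i\<^sub>j = s\<^sub>i\<^sub>j / 2\<close> give what is wanted.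
  The lemmas \<open>momentum_matrix_dual_gram\<close> and \<open>flow_out_of_arc_dual_gram\<close> carry this out.
  The other ingredient is that a quadratic form is the sum of its terms \<open>c\<^sub>i\<^sub>j x\<^sub>i x\<^sub>j\<close> with \<open>i \<le> j\<close>
  (\<open>quadratic_form_expansion\<close>).
\<close>

section \<open>Quadratic forms\<close>

lemma monom_degree_eq_sum:
  assumes "finite S" "Poly_Mapping.keys \<alpha> \<subseteq> S"
  shows "monom_degree \<alpha> = (\<Sum>i\<in>S. Poly_Mapping.lookup \<alpha> i)"
  unfolding monom_degree_def
  by (rule sum.mono_neutral_left) (use assms in \<open>auto simp: in_keys_iff\<close>)

lemma monom_degree_single_plus:
  "monom_degree (Poly_Mapping.single i 1 + \<beta>) = Suc (monom_degree \<beta>)"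
proof -
  let ?S = "insert i (Poly_Mapping.keys \<beta>)"
  have "monom_degree (Poly_Mapping.single i 1 + \<beta>)
      = (\<Sum>j\<in>?S. Poly_Mapping.lookup (Poly_Mapping.single i 1 + \<beta>) j)"
    by (rule monom_degree_eq_sum) (auto simp: in_keys_iff lookup_add lookup_single when_def split: if_splits)
  also have "\<dots> = (\<Sum>j\<in>?S. if i = j then 1 else 0) + (\<Sum>j\<in>?S. Poly_Mapping.lookup \<beta> j)"
    by (simp add: lookup_add lookup_single when_def sum.distrib del: sum.insert_if)
  also have "(\<Sum>j\<in>?S. Poly_Mapping.lookup \<beta> j) = monom_degree \<beta>"
    by (rule monom_degree_eq_sum[symmetric]) auto
  also have "(\<Sum>j\<in>?S. if i = j then 1 else 0) = (1::nat)"
    by (subst sum.delta') auto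
  finally show ?thesis by simp
qed

lemma monom_degree_eq_0_iff: "monom_degree \<alpha> = 0 \<longleftrightarrow> \<alpha> = 0"
  by (auto simp: monom_degree_def in_keys_iff intro: poly_mapping_eqI)

lemma monom_degree_SucE:
  assumes "monom_degree \<alpha> = Suc d"
  obtains i \<beta> where "\<alpha> = Poly_Mapping.single i 1 + \<beta>" "monom_degree \<beta> = d"
proof -
  from assms have "\<alpha> \<noteq> 0"
    using monom_degree_eq_0_iff[of \<alpha>] by auto
  then obtain i where i: "i \<in> Poly_Mapping.keys \<alpha>"
    by (metis all_not_in_conv keys_eq_empty)
  define \<beta> where "\<beta> = \<alpha> - Poly_Mapping.single i 1"
  have \<alpha>: "\<alpha> = Poly_Mapping.single i 1 + \<beta>"
    using i by (intro poly_mapping_eqI)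
      (auto simp: \<beta>_def lookup_add lookup_minus lookup_single when_def in_keys_iff)
  with assms have "monom_degree \<beta> = d"
    by (simp add: monom_degree_single_plus[simplified])
  with \<alpha> show thesis by (rule that)
qed

lemma keys_single_plus_single:
  "Poly_Mapping.keys (Poly_Mapping.single i 1 + Poly_Mapping.single j (1::nat)) = {i, j}"
  by (auto simp: in_keys_iff lookup_add lookup_single when_def split: if_splits)

text \<open>
  Peeling off one variable at a time presents the monomial as a product of two variables; ordering
  them by \<open>i \<le> j\<close> makes this presentation unique, by \<open>inj_on_single_plus_single\<close> below.
\<close>
lemma monom_degree_2E:
  assumes "monom_degree \<alpha> = 2"
  obtains i j where "i \<le> j" "\<alpha> = Poly_Mapping.single i 1 + Poly_Mapping.single j 1"
proof -
  from assms have "monom_degree \<alpha> = Suc 1" by simp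
  then obtain i \<beta> where \<alpha>: "\<alpha> = Poly_Mapping.single i 1 + \<beta>" and "monom_degree \<beta> = 1"
    by (rule monom_degree_SucE)
  then have "monom_degree \<beta> = Suc 0" by simp
  then obtain j \<gamma> where \<beta>: "\<beta> = Poly_Mapping.single j 1 + \<gamma>" and "monom_degree \<gamma> = 0"
    by (rule monom_degree_SucE)
  then have "\<alpha> = Poly_Mapping.single i 1 + Poly_Mapping.single j 1"
    by (simp add: \<alpha> monom_degree_eq_0_iff)
  then show thesis
    using that[of i j] that[of j i] by (cases "i \<le> j") (auto simp: add.commute)
qed

lemma inj_on_single_plus_single:
  "inj_on (\<lambda>(i, j). Poly_Mapping.single i 1 + Poly_Mapping.single j (1::nat))
     {(i, j). i \<le> (j::'a::linorder)}"
proof (rule inj_onI, clarify)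
  fix i j k l :: 'a
  assume le: "i \<le> j" "k \<le> l"
    and "Poly_Mapping.single i 1 + Poly_Mapping.single j (1::nat)
       = Poly_Mapping.single k 1 + Poly_Mapping.single l 1"
  then have "{i, j} = {k, l}"
    by (metis keys_single_plus_single)
  with le show "i = k \<and> j = l"
    by (auto simp: doubleton_eq_iff)
qed

lemma Const_Var_Var:
  "Const c * Var i * Var j
     = Poly_Mapping.single (Poly_Mapping.single i 1 + Poly_Mapping.single j 1) c"
  by (simp add: Const_def Var_def mult_single)

lemma sum_single_lookup_superset:
  assumes "finite S" "Poly_Mapping.keys f \<subseteq> S"
  shows "(\<Sum>\<alpha>\<in>S. Poly_Mapping.single \<alpha> (Poly_Mapping.lookup f \<alpha>)) = f"
proof (rule poly_mapping_eqI)
  fix \<beta>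
  have "Poly_Mapping.lookup (\<Sum>\<alpha>\<in>S. Poly_Mapping.single \<alpha> (Poly_Mapping.lookup f \<alpha>)) \<beta>
      = (\<Sum>\<alpha>\<in>S. if \<alpha> = \<beta> then Poly_Mapping.lookup f \<alpha> else 0)"
    by (simp add: lookup_sum lookup_single when_def)
  also have "\<dots> = (if \<beta> \<in> S then Poly_Mapping.lookup f \<beta> else 0)"
    using assms(1) by (rule sum.delta)
  also have "\<dots> = Poly_Mapping.lookup f \<beta>"
    using assms(2) by (auto simp: in_keys_iff)
  finally show "Poly_Mapping.lookup
      (\<Sum>\<alpha>\<in>S. Poly_Mapping.single \<alpha> (Poly_Mapping.lookup f \<alpha>)) \<beta> = Poly_Mapping.lookup f \<beta>" .
qed

definition quad_coeff :: "rpoly \<Rightarrow> nat \<Rightarrow> nat \<Rightarrow> real" where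
  "quad_coeff f i j = Poly_Mapping.lookup f (Poly_Mapping.single i 1 + Poly_Mapping.single j 1)"

lemma quad_coeff_commute: "quad_coeff f i j = quad_coeff f j i"
  by (simp add: quad_coeff_def add.commute)

lemma quadratic_form_expansion:
  assumes "f \<in> homogeneous_polys n 2"
  shows "f = (\<Sum>i\<in>{1..n}. Const (quad_coeff f i i) * Var i ^ 2)
           + (\<Sum>i\<in>{1..n}. \<Sum>j\<in>{i+1..n}. Const (quad_coeff f i j) * Var i * Var j)"
proof -
  define mon :: "nat \<times> nat \<Rightarrow> nat \<Rightarrow>\<^sub>0 nat"
    where "mon = (\<lambda>(i, j). Poly_Mapping.single i 1 + Poly_Mapping.single j 1)"
  define P where "P = Sigma {1..n} (\<lambda>i. {i..n})"
  let ?t = "\<lambda>i j. Const (quad_coeff f i j) * Var i * Var j"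
  have inj: "inj_on mon P"
    unfolding mon_def by (rule inj_on_subset[OF inj_on_single_plus_single]) (auto simp: P_def)
  have keys: "Poly_Mapping.keys f \<subseteq> mon ` P"
  proof
    fix \<alpha> assume "\<alpha> \<in> Poly_Mapping.keys f"
    with assms have vars: "Poly_Mapping.keys \<alpha> \<subseteq> {1..n}" and "monom_degree \<alpha> = 2"
      by (auto simp: homogeneous_polys_def)
    from this(2) obtain i j
      where "i \<le> j" and \<alpha>: "\<alpha> = Poly_Mapping.single i 1 + Poly_Mapping.single j 1"
      by (rule monom_degree_2E)
    with vars have "(i, j) \<in> P"
      by (simp add: \<alpha> P_def keys_single_plus_single[simplified])
    then show "\<alpha> \<in> mon ` P"
      by (rule rev_image_eqI) (simp add: mon_def \<alpha>)
  qed
  have "f = (\<Sum>\<alpha>\<in>mon ` P. Poly_Mapping.single \<alpha> (Poly_Mapping.lookup f \<alpha>))"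
    using keys by (intro sum_single_lookup_superset[symmetric]) (auto simp: P_def)
  also have "\<dots> = (\<Sum>p\<in>P. Poly_Mapping.single (mon p) (Poly_Mapping.lookup f (mon p)))"
    using inj by (simp add: sum.reindex)
  also have "\<dots> = (\<Sum>(i, j)\<in>P. ?t i j)"
    unfolding Const_Var_Var quad_coeff_def mon_def by (simp add: case_prod_unfold)
  also have "\<dots> = (\<Sum>i\<in>{1..n}. \<Sum>j\<in>{i..n}. ?t i j)"
    unfolding P_def by (rule sum.Sigma[symmetric]) auto
  also have "\<dots> = (\<Sum>i\<in>{1..n}. ?t i i + (\<Sum>j\<in>{i+1..n}. ?t i j))"
    by (intro sum.cong refl) (simp add: sum.atLeast_Suc_atMost)
  finally show ?thesis
    by (simp add: sum.distrib power2_eq_square mult.assoc)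
qed

section \<open>Momenta from dual positions\<close>

definition cyclic_index :: "nat \<Rightarrow> nat \<Rightarrow> nat" where
  "cyclic_index n i = (if i = Suc n then 1 else i)"

text \<open>
  This is \<open>(y\<^sub>a\<^sub>+\<^sub>1 - y\<^sub>a) \<cdot> (y\<^sub>b\<^sub>+\<^sub>1 - y\<^sub>b)\<close> expanded in terms of the (formal) Gram matrix
  \<open>g\<^sub>i\<^sub>j = y\<^sub>i \<cdot> y\<^sub>j\<close>, where \<open>y\<^sub>i\<close> is the position dual to the internal edge \<open>i\<close>.
\<close>
definition dual_gram_momenta :: "nat \<Rightarrow> (nat \<Rightarrow> nat \<Rightarrow> real) \<Rightarrow> nat \<Rightarrow> nat \<Rightarrow> real" where
  "dual_gram_momenta n g a b =
     (let h = \<lambda>i j. g (cyclic_index n i) (cyclic_index n j)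
      in (h (Suc a) (Suc b) - h a (Suc b)) - (h (Suc a) b - h a b))"

lemma sum_dual_gram_momenta:
  assumes "i \<le> j"
  shows "(\<Sum>b\<in>{i..<j}. dual_gram_momenta n g a b) =
     (g (cyclic_index n (Suc a)) (cyclic_index n j) - g (cyclic_index n a) (cyclic_index n j)) -
     (g (cyclic_index n (Suc a)) (cyclic_index n i) - g (cyclic_index n a) (cyclic_index n i))"
  unfolding dual_gram_momenta_def Let_def using assms by (rule sum_Suc_diff')

text \<open>The row sums telescope around the whole cycle, back to the starting position.\<close>
lemma momentum_matrix_dual_gram:
  assumes "\<And>i j. g i j = g j i"
  shows "momentum_matrix n (dual_gram_momenta n g)"
  unfolding momentum_matrix_def
proof (intro conjI ballI)
  fix a b
  show "dual_gram_momenta n g a b = dual_gram_momenta n g b a"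
    by (simp add: dual_gram_momenta_def Let_def assms[of "cyclic_index n a"]
        assms[of "cyclic_index n (Suc a)"])
next
  fix a
  have "(\<Sum>b\<in>{1..n}. dual_gram_momenta n g a b) = (\<Sum>b\<in>{1..<Suc n}. dual_gram_momenta n g a b)"
    by (simp add: atLeastLessThanSuc_atLeastAtMost)
  also have "\<dots> = 0"
    by (subst sum_dual_gram_momenta) (simp_all add: cyclic_index_def)
  finally show "(\<Sum>b\<in>{1..n}. dual_gram_momenta n g a b) = 0" .
qed

text \<open>
  By momentum conservation the flow out of a set of vertices is minus the square of its total
  momentum, a sum over pairs inside the set.
\<close>
lemma flow_out_eq_minus_inner_sum:
  assumes "momentum_matrix n k" "I \<subseteq> {1..n}"
  shows "(\<Sum>a\<in>I. \<Sum>b\<in>{1..n} - I. k a b) = - (\<Sum>a\<in>I. \<Sum>b\<in>I. k a b)"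
proof -
  have "(\<Sum>b\<in>{1..n} - I. k a b) = - (\<Sum>b\<in>I. k a b)" if "a \<in> I" for a
    using assms that sum_diff[of "{1..n}" I "k a"] by (auto simp: momentum_matrix_def)
  then show ?thesis
    by (simp add: sum_negf)
qed

text \<open>
  An arc with \<open>1 \<le> i < j \<le> n\<close> never crosses the seam between \<open>v\<^sub>n\<close> and \<open>v\<^sub>1\<close>, so its total
  momentum telescopes to \<open>y\<^sub>j - y\<^sub>i\<close>.
\<close>
lemma flow_out_of_arc_dual_gram:
  assumes sym: "\<And>i j. g i j = g j i" and "1 \<le> i" "i < j" "j \<le> n"
  shows "(\<Sum>a\<in>arc i j. \<Sum>b\<in>{1..n} - arc i j. dual_gram_momenta n g a b)
       = 2 * g i j - g i i - g j j"
proof -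
  let ?c = "cyclic_index n"
  have [simp]: "?c i = i" "?c j = j"
    using assms by (auto simp: cyclic_index_def)
  have "(\<Sum>a\<in>arc i j. \<Sum>b\<in>{1..n} - arc i j. dual_gram_momenta n g a b)
      = - (\<Sum>a\<in>{i..<j}. \<Sum>b\<in>{i..<j}. dual_gram_momenta n g a b)"
    unfolding arc_def
    by (rule flow_out_eq_minus_inner_sum[OF momentum_matrix_dual_gram[OF sym]])
      (use assms in auto)
  also have "(\<Sum>a\<in>{i..<j}. \<Sum>b\<in>{i..<j}. dual_gram_momenta n g a b)
      = (\<Sum>a\<in>{i..<j}. (g (?c (Suc a)) j - g (?c a) j) - (g (?c (Suc a)) i - g (?c a) i))"
    using assms by (intro sum.cong refl) (simp add: sum_dual_gram_momenta)
  also have "\<dots> = (\<Sum>a\<in>{i..<j}. g (?c (Suc a)) j - g (?c a) j)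
      - (\<Sum>a\<in>{i..<j}. g (?c (Suc a)) i - g (?c a) i)"
    by (rule sum_subtractf)
  also have "\<dots> = (g j j - g i j) - (g j i - g i i)"
    using assms sum_Suc_diff'[of i j "\<lambda>a. g (?c a) j"] sum_Suc_diff'[of i j "\<lambda>a. g (?c a) i"]
    by simp
  finally show ?thesis
    using sym[of j i] by simp
qed

section \<open>Surjectivity of the one-loop Symanzik polynomial\<close>

theorem theorem3p2:
  fixes n :: nat and f :: rpoly
  assumes "n \<ge> 1"
    and "f \<in> homogeneous_polys n 2"
  shows "\<exists>(m :: nat \<Rightarrow> real) (k :: nat \<Rightarrow> nat \<Rightarrow> real).
           momentum_matrix n k \<and> f = symanzik_one_loop n m k"
proof -
  define m where "m = (\<lambda>i. quad_coeff f i i)"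
  \<comment> \<open>Half the part of the coefficient of \<open>x\<^sub>i x\<^sub>j\<close> that the masses leave to the momenta; the diagonal
    vanishes, so that the flow out of \<open>arc i j\<close> is \<open>2 * g i j\<close>.\<close>
  define g where "g = (\<lambda>i j. if i = j then 0 else (quad_coeff f i j - m i - m j) / 2)"
  define k where "k = dual_gram_momenta n g"
  have g_sym: "g i j = g j i" for i j
    by (simp add: g_def quad_coeff_commute[of f i j])
  have coeff: "m i + m j + (\<Sum>a\<in>arc i j. \<Sum>b\<in>{1..n} - arc i j. k a b) = quad_coeff f i j"
    if "i \<in> {1..n}" "j \<in> {i+1..n}" for i j
  proof -
    have "(\<Sum>a\<in>arc i j. \<Sum>b\<in>{1..n} - arc i j. k a b) = 2 * g i j - g i i - g j j"
      unfolding k_def by (rule flow_out_of_arc_dual_gram[OF g_sym]) (use that in auto)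
    then show ?thesis
      using that by (simp add: g_def)
  qed
  have "symanzik_one_loop n m k
      = (\<Sum>i\<in>{1..n}. Const (quad_coeff f i i) * Var i ^ 2)
        + (\<Sum>i\<in>{1..n}. \<Sum>j\<in>{i+1..n}. Const (quad_coeff f i j) * Var i * Var j)"
    unfolding symanzik_one_loop_def
    by (intro arg_cong2[where f = "(+)"] sum.cong refl) (simp only: m_def, simp only: coeff)
  also have "\<dots> = f"
    using quadratic_form_expansion[OF assms(2)] by (rule sym)
  finally show ?thesis
    using momentum_matrix_dual_gram[of g n, OF g_sym] unfolding k_def by metis
qed

end
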